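(* Let $p,r\ge 1$ and let $\mathcal S=(S_n)_{n\ge 0}$ be a linearly recursive sequence of symmetric matrices in $\mathcal M_p(\mathbb R)$ of order $r$ whose minimal polynomial $P_{\mathcal S}$ has real distinct roots. For $k\ge 0$ put $H_{r-1}^{(k)}:=(S_{i+j+k})_{0\le i,j\le r-1}$ and $H_{r-1}:=H_{r-1}^{(0)}$. Then: (1) $\mathcal S$ is a Stieltjes matrix moment sequence if and only if $H_{r-1}\succeq 0$ and $H_{r-1}^{(1)}\succeq 0$. (2) $\mathcal S$ is a Hausdorff matrix moment sequence if and only if $H_{r-1}\succeq 0$ and $H_{r-1}^{(1)}-H_{r-1}^{(2)}\succeq 0$.
   Context: $\mathcal M_p(\mathbb R)$ is the algebra of real $p\times p$ matrices. For a real square matrix $M$, $M\succeq 0$ means $M$ is symmetric positive semidefinite. A sequence $\mathcal S=(S_n)_{n\ge 0}$ in $\mathcal M_p(\mathbb R)$ is a linearly recursive matrix sequence if there are an integer $m\ge 1$ and real numbers $a_0,\dots,a_{m-1}$ with $a_{m-1}\ne 0$ such that $S_{n+1}=a_0S_n+a_1S_{n-1}+\dots+a_{m-1}S_{n-m+1}$ for all $n\ge m-1$. Every polynomial $X^m-a_0X^{m-1}-\dots-a_{m-1}$ arising from such a recurrence (for any admissible $m$) satisfied by $\mathcal S$ is called a characteristic polynomial of $\mathcal S$. The linear span of all characteristic polynomials of $\mathcal S$ is an ideal of $\mathbb R[X]$; the minimal polynomial $P_{\mathcal S}$ is its unique monic generator, and $\mathcal S$ has order $r$ if $\deg P_{\mathcal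 S}=r$. "Real distinct roots" means all complex roots are real and simple. A matrix measure is a map $\mu=(\mu_{ij})_{1\le i,j\le p}$ on the Borel sets of $\mathbb R$, with entries finite signed measures, such that $\mu(B)$ is symmetric positive semidefinite for every Borel $B$; $\operatorname{supp}(\mu)$ is the smallest closed set $F$ with $\mu(\mathbb R\setminus F)=0$. For closed $K\subseteq\mathbb R$, $\mathcal S$ is a $K$-matrix moment sequence if there is a matrix measure $\mu$ with $\operatorname{supp}(\mu)\subseteq K$ and $S_k=\int_K x^k\,d\mu(x)$ (entrywise) for every $k\ge 0$. It is called Stieltjes if $K=[0,+\infty)$ and Hausdorff if $K=[0,1]$. *)

theory Defs
  imports "HOL-Analysis.Analysis" "HOL-Computational_Algebra.Polynomial"
begin

section \<open>Positive semidefinite matrices\<close>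

text \<open>
  A square matrix with rows and columns indexed by a finite set \<open>I\<close> is a function of two arguments,
  of which only the values on \<open>I\<close> matter. This covers both \<open>p \<times> p\<close> matrices (\<open>I = UNIV\<close>, the finite
  index type) and block matrices whose number of blocks is a natural number.
\<close>

definition psd_on :: "'i set \<Rightarrow> ('i \<Rightarrow> 'i \<Rightarrow> real) \<Rightarrow> bool" where
  "psd_on I M \<longleftrightarrow> (\<forall>i\<in>I. \<forall>j\<in>I. M i j = M j i) \<and>
     (\<forall>v. 0 \<le> (\<Sum>i\<in>I. \<Sum>j\<in>I. v i * M i j * v j))"

text \<open>
  The block Hankel matrix \<open>(S\<^bsub>i+j+k\<^esub>)\<close> with \<open>0 \<le> i, j \<le> n\<close> has row and column index set
  \<open>{0..n} \<times> UNIV\<close>: block number, then index inside the block.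
\<close>

definition block_hankel :: "(nat \<Rightarrow> real ^ 'p ^ 'p) \<Rightarrow> nat \<Rightarrow> nat \<times> 'p \<Rightarrow> nat \<times> 'p \<Rightarrow> real" where
  "block_hankel S k = (\<lambda>(i, a) (j, b). S (i + j + k) $ a $ b)"

definition block_index :: "nat \<Rightarrow> (nat \<times> 'p) set" where
  "block_index n = {0..n} \<times> UNIV"


section \<open>Linearly recursive matrix sequences\<close>

definition satisfies_recurrence ::
    "(nat \<Rightarrow> real ^ 'p ^ 'p) \<Rightarrow> nat \<Rightarrow> (nat \<Rightarrow> real) \<Rightarrow> bool" where
  "satisfies_recurrence S m a \<longleftrightarrow> 1 \<le> m \<and> a (m - 1) \<noteq> 0 \<and>
     (\<forall>n\<ge>m - 1. S (n + 1) = (\<Sum>i<m. a i *\<^sub>R S (n - i)))"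

definition linearly_recursive :: "(nat \<Rightarrow> real ^ 'p ^ 'p) \<Rightarrow> bool" where
  "linearly_recursive S \<longleftrightarrow> (\<exists>m a. satisfies_recurrence S m a)"

definition recurrence_poly :: "nat \<Rightarrow> (nat \<Rightarrow> real) \<Rightarrow> real poly" where
  "recurrence_poly m a = monom 1 m - (\<Sum>i<m. monom (a i) (m - 1 - i))"

definition characteristic_polys :: "(nat \<Rightarrow> real ^ 'p ^ 'p) \<Rightarrow> real poly set" where
  "characteristic_polys S = {recurrence_poly m a | m a. satisfies_recurrence S m a}"

text \<open>
  The minimal polynomial is the monic generator of the ideal spanned (as a real vector space) by the
  characteristic polynomials; it is meaningful for linearly recursive sequences only.
\<close>

definition minimal_poly :: "(nat \<Rightarrow> real ^ 'p ^ 'p) \<Rightarrow> real poly" where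
  "minimal_poly S =
     (THE P. lead_coeff P = 1 \<and> module.span smult (characteristic_polys S) = {P * Q | Q. True})"

definition recurrence_order :: "(nat \<Rightarrow> real ^ 'p ^ 'p) \<Rightarrow> nat" where
  "recurrence_order S = degree (minimal_poly S)"

definition real_distinct_roots :: "real poly \<Rightarrow> bool" where
  "real_distinct_roots P \<longleftrightarrow>
     (\<forall>z::complex. poly (map_poly complex_of_real P) z = 0 \<longrightarrow>
        z \<in> \<real> \<and> order z (map_poly complex_of_real P) = 1)"


section \<open>Finite signed measures and their integrals\<close>

text \<open>Set functions are only constrained on Borel sets; their values elsewhere are irrelevant.\<close>

definition finite_signed_measure :: "(real set \<Rightarrow> real) \<Rightarrow> bool" where
  "finite_signed_measure \<nu> \<longleftrightarrow> \<nu> {} = 0 \<and>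
     (\<forall>A::nat \<Rightarrow> real set. range A \<subseteq> sets borel \<longrightarrow> disjoint_family A \<longrightarrow>
        (\<lambda>n. \<nu> (A n)) sums \<nu> (\<Union>n. A n))"

text \<open>
  Jordan decomposition: the positive part is the upper variation
  \<open>B \<mapsto> sup {\<nu> A | A Borel, A \<subseteq> B}\<close>, the negative part is the upper variation of \<open>- \<nu>\<close>.
  The empty set competes in the supremum, so the truncation of negative values by \<open>ennreal\<close> is harmless.
\<close>

definition pos_part_measure :: "(real set \<Rightarrow> real) \<Rightarrow> real measure" where
  "pos_part_measure \<nu> =
     measure_of UNIV (sets borel) (\<lambda>B. SUP A\<in>{A \<in> sets borel. A \<subseteq> B}. ennreal (\<nu> A))"

definition neg_part_measure :: "(real set \<Rightarrow> real) \<Rightarrow> real measure" where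
  "neg_part_measure \<nu> = pos_part_measure (\<lambda>B. - \<nu> B)"

definition signed_integrable_on :: "(real set \<Rightarrow> real) \<Rightarrow> real set \<Rightarrow> (real \<Rightarrow> real) \<Rightarrow> bool" where
  "signed_integrable_on \<nu> K f \<longleftrightarrow>
     set_integrable (pos_part_measure \<nu>) K f \<and> set_integrable (neg_part_measure \<nu>) K f"

definition signed_integral_on :: "(real set \<Rightarrow> real) \<Rightarrow> real set \<Rightarrow> (real \<Rightarrow> real) \<Rightarrow> real" where
  "signed_integral_on \<nu> K f =
     (LINT x:K|pos_part_measure \<nu>. f x) - (LINT x:K|neg_part_measure \<nu>. f x)"


section \<open>Matrix measures and matrix moment sequences\<close>

definition matrix_measure :: "(real set \<Rightarrow> real ^ 'p ^ 'p) \<Rightarrow> bool" where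
  "matrix_measure \<mu> \<longleftrightarrow>
     (\<forall>i j. finite_signed_measure (\<lambda>B. \<mu> B $ i $ j)) \<and>
     (\<forall>B\<in>sets borel. psd_on UNIV (\<lambda>i j. \<mu> B $ i $ j))"

text \<open>
  For a matrix measure the closed sets with null complement are closed under arbitrary intersections
  (null open sets of the trace measure; the line is second countable), so the intersection is itself
  the smallest such set.
\<close>

definition matrix_support :: "(real set \<Rightarrow> real ^ 'p ^ 'p) \<Rightarrow> real set" where
  "matrix_support \<mu> = \<Inter>{F. closed F \<and> \<mu> (UNIV - F) = 0}"

definition matrix_moment_sequence :: "real set \<Rightarrow> (nat \<Rightarrow> real ^ 'p ^ 'p) \<Rightarrow> bool" where
  "matrix_moment_sequence K S \<longleftrightarrow>
     (\<exists>\<mu>. matrix_measure \<mu> \<and> matrix_support \<mu> \<subseteq> K \<and>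
        (\<forall>k i j. signed_integrable_on (\<lambda>B. \<mu> B $ i $ j) K (\<lambda>x. x ^ k) \<and>
                 S k $ i $ j = signed_integral_on (\<lambda>B. \<mu> B $ i $ j) K (\<lambda>x. x ^ k)))"

definition stieltjes_moment_sequence :: "(nat \<Rightarrow> real ^ 'p ^ 'p) \<Rightarrow> bool" where
  "stieltjes_moment_sequence S \<longleftrightarrow> matrix_moment_sequence {0..} S"

definition hausdorff_moment_sequence :: "(nat \<Rightarrow> real ^ 'p ^ 'p) \<Rightarrow> bool" where
  "hausdorff_moment_sequence S \<longleftrightarrow> matrix_moment_sequence {0..1} S"

end

theory Submission
  imports Defs "HOL-Computational_Algebra.Fundamental_Theorem_Algebra"
begin

text \<open>
  If \<open>c\<close> is a characteristic polynomial and \<open>\<mu>\<close> represents \<open>S\<close> on \<open>K\<close>, then \<open>\<integral> c\<^sup>2 d\<mu>\<^sub>a\<^sub>a = 0\<close> for every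
  diagonal entry, so the positive semidefinite \<open>\<mu>\<close> vanishes on Borel subsets of \<open>K\<close> away from the roots
  of \<open>c\<close>. Hence \<open>S\<^sub>n = \<Sum> z\<^sup>n T\<^sub>z\<close> with finitely many nodes \<open>z \<in> K\<close> and \<open>T\<^sub>z \<succeq> 0\<close>, which makes the Hankel
  matrix of \<open>S\<close>, localized at any polynomial \<open>g\<close> that is nonnegative on \<open>K\<close>, positive semidefinite.
  Conversely, the simple real roots of the minimal polynomial yield \<open>S\<^sub>n = \<Sum> z\<^sup>n T\<^sub>z\<close> with all \<open>T\<^sub>z \<noteq> 0\<close>,
  and testing the Hankel matrices against Lagrange basis polynomials gives \<open>T\<^sub>z \<succeq> 0\<close> and
  \<open>g(z) T\<^sub>z \<succeq> 0\<close>, so \<open>g(z) \<ge> 0\<close> at every node. The two cases are \<open>g = X\<close> and \<open>g = X - X\<^sup>2\<close>.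
\<close>

section \<open>Upper variation and atomic signed measures\<close>

lemma finite_signed_measure_Un:
  assumes "finite_signed_measure \<nu>" "A \<in> sets borel" "B \<in> sets borel" "A \<inter> B = {}"
  shows "\<nu> (A \<union> B) = \<nu> A + \<nu> B"
proof -
  have "(\<lambda>n. \<nu> (binaryset A B n)) sums (\<nu> A + \<nu> B)"
    using assms(1) by (intro binaryset_sums) (simp add: finite_signed_measure_def)
  moreover have "(\<lambda>n. \<nu> (binaryset A B n)) sums \<nu> (\<Union>n. binaryset A B n)"
    using assms
    by (intro conjunct2[OF assms(1)[unfolded finite_signed_measure_def], rule_format])
       (auto simp: range_binaryset_eq disjoint_family_on_def binaryset_def)
  ultimately show ?thesis
    by (metis UN_binaryset_eq sums_unique2)
qed

lemma finite_signed_measure_uminus: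
  "finite_signed_measure \<nu> \<Longrightarrow> finite_signed_measure (\<lambda>B. - \<nu> B)"
  unfolding finite_signed_measure_def by (intro conjI allI impI sums_minus) simp_all

lemma ennreal_sum_le: "ennreal (\<Sum>i\<in>I. f i) \<le> (\<Sum>i\<in>I. ennreal (f i))"
proof (induction I rule: infinite_finite_induct)
  case (insert i I)
  have "ennreal (f i + sum f I) \<le> ennreal (f i) + ennreal (sum f I)"
    by (auto simp: ennreal_plus_if intro!: ennreal_leI)
  with insert show ?case
    by (auto intro: order_trans add_left_mono)
qed auto

text \<open>This is the raw set function handed to \<open>measure_of\<close> in
  \<open>pos_part_measure\<close>. Reading off its values from the resulting measure requires
  countable additivity, which is established for the set function first.\<close>

definition upper_variation :: "(real set \<Rightarrow> real) \<Rightarrow> real set \<Rightarrow> ennreal" where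
  "upper_variation \<nu> B = (SUP A\<in>{A \<in> sets borel. A \<subseteq> B}. ennreal (\<nu> A))"

lemma upper_variation_upper:
  "A \<in> sets borel \<Longrightarrow> A \<subseteq> B \<Longrightarrow> ennreal (\<nu> A) \<le> upper_variation \<nu> B"
  unfolding upper_variation_def by (rule SUP_upper) auto

lemma upper_variation_mono: "B \<subseteq> C \<Longrightarrow> upper_variation \<nu> B \<le> upper_variation \<nu> C"
  unfolding upper_variation_def by (rule SUP_subset_mono) auto

lemma upper_variation_superadditive:
  assumes \<nu>: "finite_signed_measure \<nu>" and "B \<inter> C = {}"
  shows "upper_variation \<nu> B + upper_variation \<nu> C \<le> upper_variation \<nu> (B \<union> C)"
proof -
  have sum_le: "ennreal (\<nu> X) + ennreal (\<nu> Y) \<le> upper_variation \<nu> (B \<union> C)"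
    if "X \<in> sets borel" "X \<subseteq> B" "Y \<in> sets borel" "Y \<subseteq> C" for X Y
  proof -
    have "\<nu> (X \<union> Y) = \<nu> X + \<nu> Y"
      using that assms by (intro finite_signed_measure_Un) auto
    \<comment> \<open>\<open>ennreal\<close> cuts negative values to 0 and so need not respect the
      sum. If one of the two values is negative, the bound for the other suffices; otherwise the
      bound for the union applies.\<close>
    moreover have "ennreal (\<nu> X) \<le> upper_variation \<nu> (B \<union> C)"
      "ennreal (\<nu> Y) \<le> upper_variation \<nu> (B \<union> C)"
      "ennreal (\<nu> (X \<union> Y)) \<le> upper_variation \<nu> (B \<union> C)"
      using that by (intro upper_variation_upper; auto)+
    ultimately show ?thesis
      by (auto simp add: ennreal_plus_if simp del: ennreal_plus)
  qed
  have ne: "{A \<in> sets borel. A \<subseteq> D} \<noteq> {}" for D :: "real set"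
    using sets.empty_sets by blast
  have "upper_variation \<nu> B + ennreal (\<nu> Y) \<le> upper_variation \<nu> (B \<union> C)"
    if "Y \<in> sets borel" "Y \<subseteq> C" for Y
    using that sum_le unfolding upper_variation_def[of \<nu> B] ennreal_SUP_add_left[OF ne, symmetric]
    by (auto intro!: SUP_least)
  then show ?thesis
    unfolding upper_variation_def[of \<nu> C] ennreal_SUP_add_right[OF ne]
    by (auto intro!: SUP_least)
qed

text \<open>One inequality follows from finite superadditivity and monotonicity. For the other, a
  competitor \<open>A\<close> inside the union is cut into the pieces \<open>A \<inter> B n\<close>,
  over which \<nu> itself is countably additive.\<close>

lemma upper_variation_countably_additive:
  assumes \<nu>: "finite_signed_measure \<nu>"
  shows "countably_additive (sets borel) (upper_variation \<nu>)"
proof (rule countably_additiveI)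
  fix B :: "nat \<Rightarrow> real set"
  assume B: "range B \<subseteq> sets borel" and disj: "disjoint_family B"
  have "(\<Sum>n<N. upper_variation \<nu> (B n)) \<le> upper_variation \<nu> (\<Union>n<N. B n)" for N
  proof (induction N)
    case (Suc N)
    have "(\<Sum>n<Suc N. upper_variation \<nu> (B n))
        \<le> upper_variation \<nu> (\<Union>n<N. B n) + upper_variation \<nu> (B N)"
      using Suc by (simp add: add_right_mono)
    also have "\<dots> \<le> upper_variation \<nu> ((\<Union>n<N. B n) \<union> B N)"
    proof (intro upper_variation_superadditive[OF \<nu>])
      show "(\<Union>n<N. B n) \<inter> B N = {}"
        using disj by (auto simp: disjoint_family_on_def dest: less_imp_neq)
    qed
    also have "(\<Union>n<N. B n) \<union> B N = (\<Union>n<Suc N. B n)"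
      by (auto simp: less_Suc_eq)
    finally show ?case .
  qed simp
  also have "upper_variation \<nu> (\<Union>n<N. B n) \<le> upper_variation \<nu> (\<Union>n. B n)" for N
    by (rule upper_variation_mono) auto
  finally have ge: "(\<Sum>n. upper_variation \<nu> (B n)) \<le> upper_variation \<nu> (\<Union>n. B n)"
    by (auto simp: suminf_eq_SUP intro!: SUP_least)
  have "ennreal (\<nu> A) \<le> (\<Sum>n. upper_variation \<nu> (B n))"
    if A: "A \<in> sets borel" "A \<subseteq> (\<Union>n. B n)" for A
  proof -
    have "(\<lambda>n. \<nu> (A \<inter> B n)) sums \<nu> (\<Union>n. A \<inter> B n)"
      using A B disj
      by (intro conjunct2[OF \<nu>[unfolded finite_signed_measure_def], rule_format])
         (fastforce simp: disjoint_family_on_def)+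
    moreover have "(\<Union>n. A \<inter> B n) = A"
      using A by auto
    ultimately have lim: "(\<lambda>N. ennreal (\<Sum>n<N. \<nu> (A \<inter> B n))) \<longlonglongrightarrow> ennreal (\<nu> A)"
      by (auto simp: sums_def intro!: tendsto_ennrealI)
    have "ennreal (\<Sum>n<N. \<nu> (A \<inter> B n)) \<le> (\<Sum>n. upper_variation \<nu> (B n))" for N
    proof -
      have "ennreal (\<Sum>n<N. \<nu> (A \<inter> B n)) \<le> (\<Sum>n<N. upper_variation \<nu> (B n))"
        using A B by (intro order_trans[OF ennreal_sum_le] sum_mono upper_variation_upper) auto
      also have "\<dots> \<le> (\<Sum>n. upper_variation \<nu> (B n))"
        by (intro sum_le_suminf) auto
      finally show ?thesis .
    qed
    then show ?thesis
      by (intro LIMSEQ_le_const2[OF lim]) auto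
  qed
  then have "upper_variation \<nu> (\<Union>n. B n) \<le> (\<Sum>n. upper_variation \<nu> (B n))"
    unfolding upper_variation_def[of \<nu> "\<Union>n. B n"] by (auto intro!: SUP_least)
  with ge show "(\<Sum>n. upper_variation \<nu> (B n)) = upper_variation \<nu> (\<Union>n. B n)"
    by simp
qed

section \<open>Jordan parts as measures, and integrals over finite supports\<close>

lemma sets_pos_part_measure [simp]: "sets (pos_part_measure \<nu>) = sets borel"
  using sets.sets_measure_of_eq[of "borel :: real measure"] by (simp add: pos_part_measure_def)

lemma space_pos_part_measure [simp]: "space (pos_part_measure \<nu>) = UNIV"
  using sets_eq_imp_space_eq[OF sets_pos_part_measure] by simp

lemma emeasure_pos_part_measure:
  assumes \<nu>: "finite_signed_measure \<nu>" and B: "B \<in> sets borel"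
  shows "emeasure (pos_part_measure \<nu>) B = upper_variation \<nu> B"
proof -
  have "upper_variation \<nu> {} = 0"
    using \<nu> by (auto simp: upper_variation_def finite_signed_measure_def bot_ennreal
        intro!: antisym SUP_least)
  then show ?thesis
    using upper_variation_countably_additive[OF \<nu>] B sets.sigma_algebra_axioms[of "borel :: real measure"]
    unfolding pos_part_measure_def upper_variation_def[symmetric]
    by (intro emeasure_measure_of_sigma) (auto simp: positive_def)
qed

lemma upper_variation_singleton:
  assumes "finite_signed_measure \<nu>"
  shows "upper_variation \<nu> {x} = ennreal (\<nu> {x})"
proof -
  have "{A \<in> sets borel. A \<subseteq> {x}} = {{}, {x}}"
    by (auto simp: subset_singleton_iff)
  then show ?thesis
    using assms by (simp add: upper_variation_def finite_signed_measure_def sup_absorb2)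
qed

lemma upper_variation_eq_0:
  "(\<And>A. A \<in> sets borel \<Longrightarrow> A \<subseteq> B \<Longrightarrow> \<nu> A \<le> 0) \<Longrightarrow> upper_variation \<nu> B = 0"
  by (auto simp: upper_variation_def bot_ennreal ennreal_neg intro!: antisym SUP_least)

text \<open>Almost everywhere the integrand is a finite combination of point indicators: it is zero
  off \<open>K\<close>, and \<open>K - Z\<close> is a null set.\<close>

lemma has_integral_finite_support:
  fixes f :: "real \<Rightarrow> real"
  assumes sets: "sets M = sets borel" and K: "K \<in> sets borel" and f: "f \<in> borel_measurable borel"
    and Z: "finite Z" "emeasure M (K - Z) = 0"
    and fin: "\<And>z. z \<in> Z \<Longrightarrow> emeasure M {z} < \<infinity>"
  shows "has_bochner_integral M (\<lambda>x. indicator K x *\<^sub>R f x) (\<Sum>z\<in>Z \<inter> K. f z * measure M {z})"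
proof -
  have sum: "has_bochner_integral M (\<lambda>x. \<Sum>z\<in>Z \<inter> K. f z * indicator {z} x)
      (\<Sum>z\<in>Z \<inter> K. f z * measure M {z})"
    using fin sets
    by (intro has_bochner_integral_sum has_bochner_integral_mult_right has_bochner_integral_real_indicator) auto
  have "AE x in M. x \<notin> K - Z"
    using Z K sets by (intro AE_not_in) (auto simp: null_sets_def finite_imp_closed)
  then have "AE x in M. (\<Sum>z\<in>Z \<inter> K. f z * indicator {z} x) = indicator K x *\<^sub>R f x"
  proof eventually_elim
    case (elim x)
    have "(\<Sum>z\<in>Z \<inter> K. f z * indicator {z} x) = (\<Sum>z\<in>Z \<inter> K. if x = z then f z else 0)"
      by (intro sum.cong) (auto simp: indicator_def)
    also have "\<dots> = indicator K x *\<^sub>R f x"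
      using elim Z by (auto simp: indicator_def)
    finally show ?case .
  qed
  moreover have "(\<lambda>x. indicator K x *\<^sub>R f x) \<in> borel_measurable M"
    using K f by (subst measurable_cong_sets[OF sets refl]) simp
  ultimately show ?thesis
    using sum by (subst has_bochner_integral_cong_AE[symmetric]) (auto simp: has_bochner_integral_iff)
qed

text \<open>A singleton contains only itself and the empty set, so the Jordan parts give it the
  masses \<open>max 0 (\<nu> {z})\<close> and \<open>max 0 (- \<nu> {z})\<close>, whose difference
  is \<open>\<nu> {z}\<close>.\<close>

lemma signed_integral_finite_support:
  assumes \<nu>: "finite_signed_measure \<nu>" and K: "K \<in> sets borel" and f: "f \<in> borel_measurable borel"
    and Z: "finite Z" and null: "\<And>B. B \<in> sets borel \<Longrightarrow> B \<subseteq> K - Z \<Longrightarrow> \<nu> B = 0"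
  shows "signed_integrable_on \<nu> K f"
    and "signed_integral_on \<nu> K f = (\<Sum>z\<in>Z \<inter> K. f z * \<nu> {z})"
proof -
  have *: "has_bochner_integral (pos_part_measure \<sigma>) (\<lambda>x. indicator K x *\<^sub>R f x)
      (\<Sum>z\<in>Z \<inter> K. f z * max 0 (\<sigma> {z}))"
    if \<sigma>: "finite_signed_measure \<sigma>" "\<And>B. B \<in> sets borel \<Longrightarrow> B \<subseteq> K - Z \<Longrightarrow> \<sigma> B = 0" for \<sigma>
  proof -
    have "measure (pos_part_measure \<sigma>) {z} = max 0 (\<sigma> {z})" for z
      by (simp add: measure_def emeasure_pos_part_measure \<sigma> upper_variation_singleton
          enn2real_ennreal max_def ennreal_neg)
    then show ?thesis
      using has_integral_finite_support[of "pos_part_measure \<sigma>" K f Z] K f Z \<sigma>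
      by (simp add: emeasure_pos_part_measure upper_variation_singleton upper_variation_eq_0
          finite_imp_closed)
  qed
  note pos = *[OF \<nu> null]
  have neg: "has_bochner_integral (neg_part_measure \<nu>) (\<lambda>x. indicator K x *\<^sub>R f x)
      (\<Sum>z\<in>Z \<inter> K. f z * max 0 (- \<nu> {z}))"
    unfolding neg_part_measure_def by (rule *) (use null in \<open>auto intro: finite_signed_measure_uminus \<nu>\<close>)
  show "signed_integrable_on \<nu> K f"
    using pos neg by (simp add: signed_integrable_on_def set_integrable_def has_bochner_integral_iff)
  have "signed_integral_on \<nu> K f =
      (\<Sum>z\<in>Z \<inter> K. f z * max 0 (\<nu> {z})) - (\<Sum>z\<in>Z \<inter> K. f z * max 0 (- \<nu> {z}))"
    using pos neg
    by (simp add: signed_integral_on_def set_lebesgue_integral_def has_bochner_integral_iff)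
  also have "\<dots> = (\<Sum>z\<in>Z \<inter> K. f z * \<nu> {z})"
    unfolding sum_subtractf[symmetric] by (intro sum.cong) (auto simp: max_def)
  finally show "signed_integral_on \<nu> K f = (\<Sum>z\<in>Z \<inter> K. f z * \<nu> {z})" .
qed

section \<open>The ideal of annihilating polynomials\<close>

text \<open>The Riesz functional, sending X^n to \<open>s n\<close>. Values in any real vector space
  let it act on matrix sequences as well as on their scalar entries.\<close>

definition moment_functional :: "(nat \<Rightarrow> 'v::real_vector) \<Rightarrow> real poly \<Rightarrow> 'v" where
  "moment_functional s q = (\<Sum>i\<le>degree q. coeff q i *\<^sub>R s i)"

lemma moment_functional_bound:
  "degree q \<le> n \<Longrightarrow> moment_functional s q = (\<Sum>i\<le>n. coeff q i *\<^sub>R s i)"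
  unfolding moment_functional_def by (rule sum.mono_neutral_left) (auto simp: coeff_eq_0)

lemma moment_functional_add:
  "moment_functional s (p + q) = moment_functional s p + moment_functional s q"
proof -
  let ?n = "max (degree p) (degree q)"
  have "degree (p + q) \<le> ?n"
    by (rule degree_add_le) auto
  then show ?thesis
    using moment_functional_bound[of "p + q" ?n s] moment_functional_bound[of p ?n s]
      moment_functional_bound[of q ?n s]
    by (simp add: scaleR_left_distrib sum.distrib)
qed

lemma moment_functional_smult:
  "moment_functional s (smult c p) = c *\<^sub>R moment_functional s p"
  using moment_functional_bound[OF degree_smult_le, of s c p]
  by (simp add: moment_functional_def scaleR_sum_right)

lemma moment_functional_0 [simp]: "moment_functional s 0 = 0"
  by (simp add: moment_functional_def)

lemma moment_functional_diff:
  "moment_functional s (p - q) = moment_functional s p - moment_functional s q"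
  using moment_functional_add[of s p "smult (-1) q"] moment_functional_smult[of s "-1" q] by simp

lemma moment_functional_sum:
  "moment_functional s (\<Sum>i\<in>I. f i) = (\<Sum>i\<in>I. moment_functional s (f i))"
  by (induction I rule: infinite_finite_induct) (auto simp: moment_functional_add)

lemma moment_functional_monom [simp]: "moment_functional s (monom c n) = c *\<^sub>R s n"
proof -
  have "moment_functional s (monom c n) = (\<Sum>i\<le>n. (if i = n then c *\<^sub>R s n else 0))"
    by (subst moment_functional_bound[OF degree_monom_le]) (auto intro!: sum.cong simp del: sum.delta)
  then show ?thesis
    by simp
qed

text \<open>Killing all multiples of \<open>q\<close>, and not only \<open>q\<close>, encodes the
  recurrence at every shift and makes the set an ideal.\<close>

definition annihilator :: "(nat \<Rightarrow> 'v::real_vector) \<Rightarrow> real poly set" where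
  "annihilator s = {q. \<forall>p. moment_functional s (p * q) = 0}"

lemma annihilatorD: "q \<in> annihilator s \<Longrightarrow> moment_functional s (p * q) = 0"
  by (simp add: annihilator_def)

lemma annihilator_add: "p \<in> annihilator s \<Longrightarrow> q \<in> annihilator s \<Longrightarrow> p + q \<in> annihilator s"
  by (simp add: annihilator_def distrib_left moment_functional_add)

lemma annihilator_mult: "q \<in> annihilator s \<Longrightarrow> p * q \<in> annihilator s"
  by (simp add: annihilator_def flip: mult.assoc)

lemma annihilator_smult: "q \<in> annihilator s \<Longrightarrow> smult c q \<in> annihilator s"
  using annihilator_mult[of q s "[:c:]"] by simp

lemma annihilator_diff: "p \<in> annihilator s \<Longrightarrow> q \<in> annihilator s \<Longrightarrow> p - q \<in> annihilator s"
  by (simp add: annihilator_def right_diff_distrib moment_functional_diff)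

lemma annihilator_monomI:
  assumes "\<And>n. moment_functional s (monom 1 n * q) = 0"
  shows "q \<in> annihilator s"
proof -
  have "moment_functional s (p * q) = 0" for p
  proof -
    have "p * q = (\<Sum>i\<le>degree p. smult (coeff p i) (monom 1 i * q))"
      by (subst poly_as_sum_of_monoms[of p, symmetric])
         (simp add: sum_distrib_right smult_monom flip: mult_smult_left)
    then show ?thesis
      using assms by (simp add: moment_functional_sum moment_functional_smult)
  qed
  then show ?thesis
    by (simp add: annihilator_def)
qed

text \<open>On X^k times the polynomial, the functional measures the failure of the recurrence at
  \<open>n = k + m - 1\<close>; as \<open>k\<close> varies, this covers all
  \<open>n \<ge> m - 1\<close>.\<close>

lemma recurrence_poly_annihilator_iff:
  assumes "1 \<le> m"
  shows "recurrence_poly m a \<in> annihilator s \<longleftrightarrow>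
    (\<forall>n\<ge>m - 1. s (n + 1) = (\<Sum>i<m. a i *\<^sub>R s (n - i)))"
proof -
  have functional: "moment_functional s (monom 1 k * recurrence_poly m a) =
      s (k + m) - (\<Sum>i<m. a i *\<^sub>R s (k + m - 1 - i))" for k
  proof -
    have "monom 1 k * recurrence_poly m a =
        monom 1 (k + m) - (\<Sum>i<m. monom (a i) (k + (m - 1 - i)))"
      by (simp add: recurrence_poly_def right_diff_distrib sum_distrib_left mult_monom)
    moreover have "(\<Sum>i<m. a i *\<^sub>R s (k + (m - 1 - i))) = (\<Sum>i<m. a i *\<^sub>R s (k + m - 1 - i))"
      by (intro sum.cong) auto
    ultimately show ?thesis
      by (simp add: moment_functional_diff moment_functional_sum)
  qed
  show ?thesis
  proof
    assume "recurrence_poly m a \<in> annihilator s"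
    then have *: "s (k + m) = (\<Sum>i<m. a i *\<^sub>R s (k + m - 1 - i))" for k
      using functional[of k] by (simp add: annihilatorD)
    show "\<forall>n\<ge>m - 1. s (n + 1) = (\<Sum>i<m. a i *\<^sub>R s (n - i))"
    proof (intro allI impI)
      fix n assume "m - 1 \<le> n"
      then show "s (n + 1) = (\<Sum>i<m. a i *\<^sub>R s (n - i))"
        using *[of "n + 1 - m"] assms by simp
    qed
  next
    assume rec: "\<forall>n\<ge>m - 1. s (n + 1) = (\<Sum>i<m. a i *\<^sub>R s (n - i))"
    have "s (k + m) = (\<Sum>i<m. a i *\<^sub>R s (k + m - 1 - i))" for k
      using rec[rule_format, of "k + m - 1"] assms by simp
    then show "recurrence_poly m a \<in> annihilator s"
      by (intro annihilator_monomI) (simp add: functional)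
  qed
qed

section \<open>Characteristic polynomials and their monic generator\<close>

lemma coeff_recurrence_poly:
  "coeff (recurrence_poly m a) k = (if k = m then 1 else if k < m then - a (m - 1 - k) else 0)"
proof -
  have "(\<Sum>i<m. coeff (monom (a i) (m - 1 - i)) k) =
      (\<Sum>i<m. if i = m - 1 - k \<and> k < m then a i else 0)"
    by (intro sum.cong) auto
  also have "\<dots> = (if k < m then a (m - 1 - k) else 0)"
    by auto
  finally show ?thesis
    by (simp add: recurrence_poly_def coeff_sum)
qed

lemma degree_recurrence_poly [simp]: "degree (recurrence_poly m a) = m"
  by (rule antisym) (auto intro!: degree_le le_degree simp: coeff_recurrence_poly)

text \<open>The constant term of \<open>recurrence_poly m a\<close> is \<open>- a (m - 1)\<close>,
  so the condition on the last coefficient becomes a nonzero constant term; conversely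
  \<open>a\<close> is read off from the coefficients of \<open>q\<close>.\<close>

lemma characteristic_polys_eq:
  "characteristic_polys S =
    {q \<in> annihilator S. lead_coeff q = 1 \<and> 1 \<le> degree q \<and> coeff q 0 \<noteq> 0}" (is "_ = ?C")
proof (intro set_eqI iffI)
  fix q assume "q \<in> characteristic_polys S"
  then show "q \<in> ?C"
    by (auto simp: characteristic_polys_def satisfies_recurrence_def
        recurrence_poly_annihilator_iff coeff_recurrence_poly)
next
  fix q assume q: "q \<in> ?C"
  define m where "m = degree q"
  define a where "a i = - coeff q (m - 1 - i)" for i
  have "recurrence_poly m a = q"
    using q by (intro poly_eqI) (auto simp: coeff_recurrence_poly m_def a_def coeff_eq_0)
  moreover from this have "satisfies_recurrence S m a"
    using q recurrence_poly_annihilator_iff[of m a S]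
    by (auto simp: satisfies_recurrence_def m_def a_def)
  ultimately show "q \<in> characteristic_polys S"
    unfolding characteristic_polys_def by blast
qed

interpretation poly_module: module "smult :: real \<Rightarrow> real poly \<Rightarrow> real poly"
  by standard (simp_all add: smult_add_right smult_add_left)

text \<open>
  An element \<open>q\<close> of the ideal need not have a nonzero constant term. With a characteristic
  polynomial \<open>c\<close> and \<open>N > degree q\<close>, both \<open>(X^N + 1) * c\<close> and, for \<open>t = 1\<close> or \<open>t = -1\<close>,
  \<open>(X^N + 1) * c + t * q\<close> are characteristic, and their difference is a multiple of \<open>q\<close>.
\<close>

lemma span_characteristic_polys:
  assumes "linearly_recursive S"
  shows "module.span smult (characteristic_polys S) = annihilator S"
proof
  show "poly_module.span (characteristic_polys S) \<subseteq> annihilator S"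
    by (rule poly_module.span_minimal)
       (auto simp: characteristic_polys_eq poly_module.subspace_def annihilator_add
         annihilator_smult, simp add: annihilator_def)
next
  obtain c where c: "c \<in> annihilator S" "lead_coeff c = 1" "1 \<le> degree c" "coeff c 0 \<noteq> 0"
    using assms characteristic_polys_eq[of S]
    unfolding linearly_recursive_def characteristic_polys_def by blast
  show "annihilator S \<subseteq> poly_module.span (characteristic_polys S)"
  proof
    fix q assume q: "q \<in> annihilator S"
    define N where "N = Suc (degree q)"
    define d where "d = (monom 1 N + 1) * c"
    \<comment> \<open>The constant term of \<open>d + smult t q\<close> is that of \<open>c\<close>
      plus \<open>t\<close> times that of \<open>q\<close>. If \<open>t = 1\<close> makes it cancel,
      then \<open>t = - 1\<close> gives twice the constant term of \<open>c\<close>.\<close>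
    define t :: real where "t = (if coeff c 0 + coeff q 0 = 0 then - 1 else 1)"
    have "degree (monom (1::real) N + 1) = N"
      by (subst degree_add_eq_left) (auto simp: degree_monom_eq N_def)
    then have lead: "coeff (monom (1::real) N + 1) N = 1" "lead_coeff (monom (1::real) N + 1) = 1"
      by (simp_all add: N_def)
    then have "monom (1::real) N + 1 \<noteq> 0"
      by (metis leading_coeff_0_iff zero_neq_one)
    then have deg: "degree d = N + degree c"
      using c \<open>degree (monom 1 N + 1) = N\<close> unfolding d_def by (subst degree_mult_eq) auto
    have d: "d \<in> annihilator S" "lead_coeff d = 1" "coeff d 0 = coeff c 0"
      using c lead by (auto simp: d_def annihilator_mult lead_coeff_mult coeff_mult_0 N_def)
    have "degree (smult t q) < degree d"
      using degree_smult_le[of t q] by (auto simp: deg N_def)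
    then have "degree (d + smult t q) = degree d" "coeff (smult t q) (degree d) = 0"
      by (simp_all only: degree_add_eq_left coeff_eq_0)
    then have "degree (d + smult t q) = degree d" "lead_coeff (d + smult t q) = 1"
      using d by (simp_all only: coeff_add add_0_right)
    moreover have "coeff (d + smult t q) 0 \<noteq> 0"
      using c d by (auto simp: t_def)
    ultimately have "d + smult t q \<in> characteristic_polys S" "d \<in> characteristic_polys S"
      using c d q deg by (auto simp: characteristic_polys_eq annihilator_add annihilator_smult)
    then have "smult t ((d + smult t q) - d) \<in> poly_module.span (characteristic_polys S)"
      by (intro poly_module.span_scale poly_module.span_diff poly_module.span_base)
    moreover have "smult t ((d + smult t q) - d) = q"
      by (simp add: t_def)
    ultimately show "q \<in> poly_module.span (characteristic_polys S)"
      by simp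
  qed
qed

text \<open>Division with remainder by a nonzero element of least degree, rescaled to be
  monic.\<close>

lemma annihilator_principal:
  assumes "annihilator s \<noteq> {0}"
  obtains g where "lead_coeff g = 1" "annihilator s = {g * q | q. True}"
proof -
  have "0 \<in> annihilator s"
    by (simp add: annihilator_def)
  then obtain h where h: "h \<in> annihilator s" "h \<noteq> 0"
      and h_min: "\<And>q. q \<in> annihilator s \<Longrightarrow> q \<noteq> 0 \<Longrightarrow> degree h \<le> degree q"
    using assms ex_has_least_nat[of "\<lambda>q. q \<in> annihilator s \<and> q \<noteq> 0" _ degree] by blast
  define g where "g = smult (inverse (lead_coeff h)) h"
  have g: "g \<in> annihilator s" "lead_coeff g = 1" "degree g = degree h"
    using h by (auto simp: g_def annihilator_smult)
  have "\<exists>p. q = g * p" if q: "q \<in> annihilator s" for q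
  proof -
    have "q mod g \<in> annihilator s"
      using q g by (auto simp: annihilator_diff annihilator_mult simp flip: minus_div_mult_eq_mod)
    moreover have "degree (q mod g) < degree g \<or> q mod g = 0"
      using degree_mod_less[of g q] g by force
    ultimately have "q mod g = 0"
      using h_min[of "q mod g"] g by force
    then show ?thesis
      by (metis dvdE mod_eq_0_iff_dvd)
  qed
  moreover have "g * p \<in> annihilator s" for p
    using annihilator_mult[OF g(1), of p] by (simp add: mult.commute)
  ultimately have "annihilator s = {g * q | q. True}"
    by blast
  with g(2) show thesis
    by (rule that)
qed

text \<open>Justifies the definite description: existence is principality of the ideal, and two
  monic generators divide each other, hence coincide.\<close>

lemma minimal_poly:
  assumes "linearly_recursive S"
  shows "lead_coeff (minimal_poly S) = 1"
    and "annihilator S = {minimal_poly S * Q | Q. True}"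
proof -
  obtain c where "c \<in> characteristic_polys S"
    using assms unfolding linearly_recursive_def characteristic_polys_def by blast
  then have "c \<in> annihilator S" "c \<noteq> 0"
    unfolding characteristic_polys_eq by auto
  then have "annihilator S \<noteq> {0}"
    by blast
  then obtain g where g: "lead_coeff g = 1" "annihilator S = {g * q | q. True}"
    by (rule annihilator_principal)
  have "minimal_poly S = g"
    unfolding minimal_poly_def span_characteristic_polys[OF assms]
  proof (rule the_equality)
    fix P assume P: "lead_coeff P = 1 \<and> annihilator S = {P * Q |Q. True}"
    have "P * 1 \<in> annihilator S"
      unfolding conjunct2[OF P] by blast
    moreover have "g * 1 \<in> annihilator S"
      unfolding g(2) by blast
    ultimately obtain p q where "P * 1 = g * q" "g * 1 = P * p"
      using P g(2) by blast
    then have "P dvd g" "g dvd P"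
      by (metis dvdI mult.right_neutral)+
    then obtain k where k: "g = P * k" and "degree g = degree P"
      using P g(1) by (metis dvdE dvd_imp_degree_le leading_coeff_0_iff order_antisym zero_neq_one)
    moreover have "lead_coeff k = 1"
      using k P g(1) lead_coeff_mult[of P k] by simp
    moreover from this have "P \<noteq> 0" "k \<noteq> 0"
      using P by auto
    ultimately have "degree k = 0"
      using degree_mult_eq[of P k] by simp
    with \<open>lead_coeff k = 1\<close> show "P = g"
      using k by (auto elim!: degree_eq_zeroE)
  qed (use g in blast)
  with g show "lead_coeff (minimal_poly S) = 1" "annihilator S = {minimal_poly S * Q | Q. True}"
    by blast+
qed

section \<open>Simple real roots, interpolation and atomic sums\<close>

lemma card_real_distinct_roots:
  assumes "real_distinct_roots P" "P \<noteq> 0"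
  shows "card {x. poly P x = 0} = degree P"
proof -
  let ?Q = "map_poly complex_of_real P"
  have Q: "?Q \<noteq> 0"
    using assms(2) by (metis map_poly_eq_0_iff of_real_0 of_real_eq_0_iff)
  have poly_of_real: "poly ?Q (complex_of_real x) = complex_of_real (poly P x)" for x
    by (induction P) (auto simp: map_poly_pCons)
  have roots: "{z. poly ?Q z = 0} = complex_of_real ` {x. poly P x = 0}"
    using assms(1) by (force simp: real_distinct_roots_def poly_of_real elim: Reals_cases)
  \<comment> \<open>Over the complex numbers the roots with multiplicity exhaust the degree; here
    each counts once and comes from exactly one real root.\<close>
  have "degree P = size (proots ?Q)"
    by (simp add: size_proots_complex degree_map_poly)
  also have "\<dots> = (\<Sum>z\<in>{z. poly ?Q z = 0}. order z ?Q)"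
    using Q by (simp add: size_multiset_overloaded_eq)
  also have "\<dots> = card {z. poly ?Q z = 0}"
    using assms(1) by (simp add: real_distinct_roots_def)
  also have "\<dots> = card {x. poly P x = 0}"
    unfolding roots by (rule card_image) (auto simp: inj_on_def)
  finally show ?thesis ..
qed

lemma lagrange_basis_exists:
  fixes z :: real
  assumes "finite Z" "z \<in> Z"
  obtains L where "degree L < card Z" "\<And>x. x \<in> Z \<Longrightarrow> poly L x = (if x = z then 1 else 0)"
proof
  define L where "L = (\<Prod>x\<in>Z - {z}. smult (1 / (z - x)) [:- x, 1:])"
  have "degree L \<le> (\<Sum>x\<in>Z - {z}. 1)"
    unfolding L_def
    by (rule order_trans[OF degree_prod_sum_le]) (use assms in \<open>auto intro!: sum_mono\<close>)
  also have "\<dots> < card Z"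
    using assms card_gt_0_iff[of Z] by (auto simp: diff_less)
  finally show "degree L < card Z" .
  show "poly L x = (if x = z then 1 else 0)" if "x \<in> Z" for x
    using assms that by (auto simp: L_def poly_prod diff_divide_distrib[symmetric] intro!: prod.neutral prod_zero)
qed

text \<open>Modulo \<open>P\<close>, a polynomial is its Lagrange interpolant at the roots, and the
  functional kills multiples of \<open>P\<close>. Hence it is a combination of point evaluations
  with weights \<open>T z\<close>, and monomials give the sequence. Membership in the span passes
  linear properties of \<open>s\<close>, such as symmetry, on to \<open>T z\<close>.\<close>

lemma recursive_atomic_representation:
  fixes s :: "nat \<Rightarrow> 'v::real_vector"
  assumes ann: "annihilator s = {P * Q | Q. True}"
    and P: "P \<noteq> 0" "card {x. poly P x = 0} = degree P"
  defines "Z \<equiv> {x. poly P x = 0}"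
  obtains T where "\<And>n. s n = (\<Sum>z\<in>Z. z ^ n *\<^sub>R T z)" "\<And>z. z \<in> Z \<Longrightarrow> T z \<noteq> 0"
    "\<And>z. T z \<in> span (range s)"
proof -
  have Z: "finite Z" "card Z = degree P"
    using P poly_roots_finite unfolding Z_def by auto
  have "\<exists>L. degree L < card Z \<and> (\<forall>x\<in>Z. poly L x = (if x = z then 1 else 0))" if "z \<in> Z" for z
    using lagrange_basis_exists[OF Z(1) that] by metis
  then obtain L where deg: "\<And>z. z \<in> Z \<Longrightarrow> degree (L z) < card Z"
      and L: "\<And>z x. z \<in> Z \<Longrightarrow> x \<in> Z \<Longrightarrow> poly (L z) x = (if x = z then 1 else 0)"
    by metis
  define T where "T z = moment_functional s (L z)" for z
  have functional: "moment_functional s q = (\<Sum>z\<in>Z. poly q z *\<^sub>R T z)" for q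
  proof -
    let ?I = "\<Sum>z\<in>Z. smult (poly q z) (L z)"
    have "P \<in> annihilator s"
      unfolding ann by (rule CollectI, rule exI[of _ 1]) simp
    \<comment> \<open>Both sides have degree below \<open>card Z\<close> and agree on
      \<open>Z\<close>. If \<open>Z\<close> is empty, \<open>P\<close> is a nonzero constant and
      both sides are 0.\<close>
    have "q mod P = ?I"
    proof (cases "Z = {}")
      case True
      with Z degree_mod_less[OF P(1), of q] show ?thesis
        by simp
    next
      case False
      then have "0 < degree P"
        using Z by (simp add: card_gt_0_iff flip: Z(2))
      then have "degree (q mod P) < degree P"
        using degree_mod_less[OF P(1), of q] by auto
      moreover have "degree ?I < degree P"
        using \<open>0 < degree P\<close> deg Z
        by (intro degree_sum_less) (auto intro: le_less_trans[OF degree_smult_le])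
      ultimately have "degree (q mod P - ?I) < card Z"
        using Z by (simp add: degree_diff_less)
      moreover have "poly (q mod P - ?I) x = 0" if "x \<in> Z" for x
      proof -
        have "poly q x = poly (q div P * P + q mod P) x"
          by simp
        then have "poly (q mod P) x = poly q x"
          using that unfolding poly_add poly_mult by (simp add: Z_def)
        moreover have "poly ?I x = (\<Sum>z\<in>Z. if x = z then poly q z else 0)"
          using that L by (auto simp: poly_sum intro!: sum.cong)
        ultimately show ?thesis
          using that Z by simp
      qed
      ultimately have "q mod P - ?I = 0"
        using card_poly_roots_bound[of "q mod P - ?I"]
          card_mono[OF poly_roots_finite, of "q mod P - ?I" Z] by force
      then show ?thesis
        by simp
    qed
    then have "q = q div P * P + ?I"
      by (metis div_mult_mod_eq)
    then have "moment_functional s q = moment_functional s (q div P * P) + moment_functional s ?I"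
      by (metis moment_functional_add)
    then show ?thesis
      using annihilatorD[OF \<open>P \<in> annihilator s\<close>]
      by (simp add: moment_functional_sum moment_functional_smult T_def)
  qed
  show thesis
  proof
    show "s n = (\<Sum>z\<in>Z. z ^ n *\<^sub>R T z)" for n
      using functional[of "monom 1 n"] by (simp add: poly_monom)
    \<comment> \<open>Otherwise \<open>L z\<close> would be a multiple of \<open>P\<close>, although
      it is nonzero and of smaller degree.\<close>
    show "T z \<noteq> 0" if z: "z \<in> Z" for z
    proof
      assume "T z = 0"
      have "moment_functional s (p * L z) = 0" for p
        unfolding functional using L z \<open>T z = 0\<close> by (auto intro!: sum.neutral)
      then have "L z \<in> annihilator s"
        by (simp add: annihilator_def)
      then have "P dvd L z"
        by (auto simp: ann)
      moreover have "L z \<noteq> 0"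
        using L[OF z z] by auto
      ultimately show False
        using deg[OF z] Z dvd_imp_degree_le by force
    qed
    show "T z \<in> span (range s)" for z
      unfolding T_def moment_functional_def by (intro span_sum span_scale) (simp add: span_base)
  qed
qed

section \<open>Atomic representing measures\<close>

lemma sum_unit_vectors:
  fixes M :: "'a::finite \<Rightarrow> 'a \<Rightarrow> real"
  shows "(\<Sum>i\<in>UNIV. \<Sum>j\<in>UNIV. of_bool (i = a) * M i j * of_bool (j = b)) = M a b"
  by (simp add: of_bool_def if_distrib[of "\<lambda>x. x * _"] if_distrib[of "\<lambda>x. _ * x"] cong: if_cong)

lemma psd_on_diag_nonneg: "psd_on (UNIV :: 'a::finite set) M \<Longrightarrow> 0 \<le> M a a"
  unfolding psd_on_def sum_unit_vectors[of a M a, symmetric]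
  by (elim conjE allE[of _ "\<lambda>i. of_bool (i = a)"])

text \<open>With a zero diagonal entry, the form at \<open>t * e_a + e_b\<close> is affine in
  \<open>t\<close> with slope \<open>2 * M a b\<close>, so it can stay nonnegative only if the slope
  is 0.\<close>

lemma psd_on_diag_eq_0:
  fixes M :: "'a::finite \<Rightarrow> 'a \<Rightarrow> real"
  assumes psd: "psd_on UNIV M" and diag: "M a a = 0"
  shows "M a b = 0"
proof (rule ccontr)
  assume "M a b \<noteq> 0"
  \<comment> \<open>Chosen so that \<open>2 * t * M a b + M b b = - 1\<close>.\<close>
  define t where "t = - (M b b + 1) / (2 * M a b)"
  define v :: "'a \<Rightarrow> real" where "v i = t * of_bool (i = a) + of_bool (i = b)" for i
  have "(\<Sum>i\<in>UNIV. \<Sum>j\<in>UNIV. v i * M i j * v j) =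
    (\<Sum>i\<in>UNIV. \<Sum>j\<in>UNIV. t * t * (of_bool (i = a) * M i j * of_bool (j = a)) +
      t * (of_bool (i = a) * M i j * of_bool (j = b)) +
      t * (of_bool (i = b) * M i j * of_bool (j = a)) +
      of_bool (i = b) * M i j * of_bool (j = b))"
    by (intro sum.cong refl) (simp add: v_def algebra_simps)
  also have "\<dots> = t * t * M a a + t * M a b + t * M b a + M b b"
    by (simp only: sum.distrib sum_distrib_left[symmetric] sum_unit_vectors)
  also have "M b a = M a b"
    using psd by (simp add: psd_on_def)
  also have "t * t * M a a + t * M a b + t * M a b + M b b = - 1"
    using \<open>M a b \<noteq> 0\<close> diag by (simp add: t_def field_simps)
  finally have "(\<Sum>i\<in>UNIV. \<Sum>j\<in>UNIV. v i * M i j * v j) = - 1" .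
  moreover have "0 \<le> (\<Sum>i\<in>UNIV. \<Sum>j\<in>UNIV. v i * M i j * v j)"
    using psd unfolding psd_on_def by blast
  ultimately show False
    by simp
qed

section \<open>From representing measures to finitely many atoms, and back\<close>

lemma moment_functional_component:
  "moment_functional (\<lambda>n. S n $ a $ b) q = moment_functional S q $ a $ b"
  by (simp add: moment_functional_def)

text \<open>For nonnegative \<nu> the negative part is the zero measure, so the signed integral is
  an ordinary one; polynomials follow by linearity.\<close>

lemma moment_sequence_integral_poly:
  assumes \<nu>: "finite_signed_measure \<nu>" and nonneg: "\<And>B. B \<in> sets borel \<Longrightarrow> 0 \<le> \<nu> B"
    and int: "\<And>k. signed_integrable_on \<nu> K (\<lambda>x. x ^ k)"
    and moments: "\<And>k. s k = signed_integral_on \<nu> K (\<lambda>x. x ^ k)"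
  shows "has_bochner_integral (pos_part_measure \<nu>) (\<lambda>x. indicator K x *\<^sub>R poly q x)
    (moment_functional s q)"
proof -
  have "upper_variation (\<lambda>B. - \<nu> B) UNIV = 0"
    using nonneg by (intro upper_variation_eq_0) simp
  then have "emeasure (neg_part_measure \<nu>) (space (neg_part_measure \<nu>)) = 0"
    unfolding neg_part_measure_def
    by (simp add: emeasure_pos_part_measure finite_signed_measure_uminus[OF \<nu>])
  then have "(LINT x:K|neg_part_measure \<nu>. x ^ k) = 0" for k :: nat
    unfolding set_lebesgue_integral_def
    by (intro integral_eq_zero_AE AE_I[where N = "space (neg_part_measure \<nu>)"]) auto
  then have "has_bochner_integral (pos_part_measure \<nu>) (\<lambda>x. indicator K x *\<^sub>R x ^ k) (s k)" for k
    using int[of k] moments[of k]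
    by (simp add: signed_integrable_on_def signed_integral_on_def set_integrable_def
        set_lebesgue_integral_def has_bochner_integral_iff)
  then have "has_bochner_integral (pos_part_measure \<nu>)
      (\<lambda>x. \<Sum>i\<le>degree q. coeff q i * (indicator K x *\<^sub>R x ^ i)) (\<Sum>i\<le>degree q. coeff q i * s i)"
    by (intro has_bochner_integral_sum has_bochner_integral_mult_right)
  then show ?thesis
    by (simp add: moment_functional_def poly_altdef sum_distrib_left mult_ac)
qed

text \<open>The square \<open>c * c\<close> is nonnegative with integral 0 over \<open>K\<close>, so
  it vanishes almost everywhere there. As \<open>c\<close> has no zero in \<open>B\<close>, the
  positive part of \<nu>, which dominates \<nu>, is 0 on \<open>B\<close>.\<close>

lemma moment_sequence_null_off_roots:
  assumes \<nu>: "finite_signed_measure \<nu>" and nonneg: "\<And>B. B \<in> sets borel \<Longrightarrow> 0 \<le> \<nu> B"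
    and int: "\<And>k. signed_integrable_on \<nu> K (\<lambda>x. x ^ k)"
    and moments: "\<And>k. s k = signed_integral_on \<nu> K (\<lambda>x. x ^ k)"
    and c: "moment_functional s (c * c) = 0"
    and B: "B \<in> sets borel" "B \<subseteq> K - {x. poly c x = 0}"
  shows "\<nu> B = 0"
proof -
  let ?M = "pos_part_measure \<nu>"
  have "has_bochner_integral ?M (\<lambda>x. indicator K x *\<^sub>R poly (c * c) x) 0"
    using moment_sequence_integral_poly[OF assms(1-4), of "c * c"] c by simp
  then have "AE x in ?M. indicator K x *\<^sub>R poly (c * c) x = 0"
    by (subst integral_nonneg_eq_0_iff_AE[symmetric])
       (auto simp: has_bochner_integral_iff intro!: AE_I2)
  then have "AE x in ?M. x \<notin> B"
  proof eventually_elim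
    case (elim x)
    then show ?case
      using B(2) by (auto simp: indicator_def)
  qed
  then have "emeasure ?M B = 0"
    using B(1) by (subst (asm) AE_iff_measurable[of B]) auto
  then have "ennreal (\<nu> B) \<le> 0"
    using upper_variation_upper[OF B(1) order.refl, of \<nu>]
    by (simp add: emeasure_pos_part_measure[OF \<nu> B(1)])
  then show ?thesis
    using nonneg[OF B(1)] by simp
qed

lemma matrix_moment_sequence_imp_atomic:
  fixes S :: "nat \<Rightarrow> real ^ 'p ^ 'p"
  assumes "linearly_recursive S" "matrix_moment_sequence K S" and K: "K \<in> sets borel"
  obtains Z T where "finite Z" "Z \<subseteq> K" "\<And>z. psd_on UNIV (\<lambda>a b. T z $ a $ b)"
    "\<And>n. S n = (\<Sum>z\<in>Z. z ^ n *\<^sub>R T z)"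
proof -
  obtain c where "c \<in> characteristic_polys S"
    using assms(1) unfolding linearly_recursive_def characteristic_polys_def by blast
  then have c: "c \<in> annihilator S" "c \<noteq> 0"
    unfolding characteristic_polys_eq by auto
  then have Z: "finite {x. poly c x = 0}"
    by (simp add: poly_roots_finite)
  obtain \<mu> where signed: "\<And>a b. finite_signed_measure (\<lambda>B. \<mu> B $ a $ b)"
      and psd: "\<And>B. B \<in> sets borel \<Longrightarrow> psd_on UNIV (\<lambda>a b. \<mu> B $ a $ b)"
      and int: "\<And>k a b. signed_integrable_on (\<lambda>B. \<mu> B $ a $ b) K (\<lambda>x. x ^ k)"
      and moments: "\<And>k a b. S k $ a $ b = signed_integral_on (\<lambda>B. \<mu> B $ a $ b) K (\<lambda>x. x ^ k)"
    using assms(2) unfolding matrix_moment_sequence_def matrix_measure_def by blast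
  have null: "\<mu> B $ a $ b = 0" if B: "B \<in> sets borel" "B \<subseteq> K - {x. poly c x = 0}" for B a b
  proof -
    have "moment_functional (\<lambda>k. S k $ a $ a) (c * c) = 0"
      by (simp add: moment_functional_component annihilatorD[OF c(1)])
    with psd_on_diag_nonneg[OF psd] have "\<mu> B $ a $ a = 0"
      by (intro moment_sequence_null_off_roots[OF signed _ int moments _ B])
    then show ?thesis
      using psd_on_diag_eq_0[OF psd[OF B(1)]] by blast
  qed
  show thesis
  proof
    show "finite ({x. poly c x = 0} \<inter> K)" "{x. poly c x = 0} \<inter> K \<subseteq> K"
      using Z by auto
    show "psd_on UNIV (\<lambda>a b. \<mu> {z} $ a $ b)" for z
      by (rule psd) simp
    \<comment> \<open>The integrals run over \<open>K\<close> only, so roots of \<open>c\<close>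
      outside \<open>K\<close> contribute no atoms.\<close>
    show "S n = (\<Sum>z\<in>{x. poly c x = 0} \<inter> K. z ^ n *\<^sub>R \<mu> {z})" for n
      using signed_integral_finite_support(2)[OF signed K _ Z null, of "\<lambda>x. x ^ n"]
      by (simp add: vec_eq_iff moments)
  qed
qed

lemma atomic_imp_matrix_moment_sequence:
  fixes S :: "nat \<Rightarrow> real ^ 'p ^ 'p"
  assumes Z: "finite Z" "Z \<subseteq> K" and K: "K \<in> sets borel"
    and psd: "\<And>z. z \<in> Z \<Longrightarrow> psd_on UNIV (\<lambda>a b. T z $ a $ b)"
    and S: "\<And>n. S n = (\<Sum>z\<in>Z. z ^ n *\<^sub>R T z)"
  shows "matrix_moment_sequence K S"
proof -
  define \<mu> :: "real set \<Rightarrow> real ^ 'p ^ 'p" where "\<mu> B = (\<Sum>z\<in>Z. indicator B z *\<^sub>R T z)" for B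
  have entry: "\<mu> B $ a $ b = (\<Sum>z\<in>Z. indicator B z * T z $ a $ b)" for B a b
    by (simp add: \<mu>_def)
  have signed: "finite_signed_measure (\<lambda>B. \<mu> B $ a $ b)" for a b
    unfolding finite_signed_measure_def entry
    by (auto intro!: sums_sum sums_mult2 indicator_sums simp: disjoint_family_on_def)
  have "psd_on UNIV (\<lambda>a b. \<mu> B $ a $ b)" for B
  proof -
    have "(\<Sum>i\<in>UNIV. \<Sum>j\<in>UNIV. v i * \<mu> B $ i $ j * v j) =
        (\<Sum>z\<in>Z. indicator B z * (\<Sum>i\<in>UNIV. \<Sum>j\<in>UNIV. v i * T z $ i $ j * v j))" for v
      unfolding entry sum_distrib_left sum_distrib_right
      by (subst sum.swap[where A = Z], subst sum.swap[where A = Z]) (simp add: mult_ac)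
    then show ?thesis
      using psd by (auto simp: psd_on_def entry intro!: sum_nonneg sum.cong)
  qed
  then have "matrix_measure \<mu>"
    using signed by (simp add: matrix_measure_def)
  moreover have "matrix_support \<mu> \<subseteq> K"
  proof -
    have "\<mu> (UNIV - Z) = 0"
      by (simp add: \<mu>_def indicator_def)
    \<comment> \<open>A finite \<open>Z\<close> is closed and has null complement, so it is among
      the sets intersected in \<open>matrix_support\<close>.\<close>
    then have "matrix_support \<mu> \<subseteq> Z"
      using Z by (auto simp: matrix_support_def finite_imp_closed)
    with Z show ?thesis
      by blast
  qed
  moreover have "signed_integrable_on (\<lambda>B. \<mu> B $ a $ b) K (\<lambda>x. x ^ k)"
    and "S k $ a $ b = signed_integral_on (\<lambda>B. \<mu> B $ a $ b) K (\<lambda>x. x ^ k)" for k a b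
  proof -
    have null: "\<mu> B $ a $ b = 0" if "B \<in> sets borel" "B \<subseteq> K - Z" for B
      using that by (auto simp: entry indicator_def intro!: sum.neutral)
    note integral = signed_integral_finite_support[OF signed K _ Z(1) null, of "\<lambda>x. x ^ k"]
    show "signed_integrable_on (\<lambda>B. \<mu> B $ a $ b) K (\<lambda>x. x ^ k)"
      by (rule integral(1)) simp_all
    have "\<mu> {z} $ a $ b = T z $ a $ b" if "z \<in> Z" for z
      using that Z(1) by (simp add: entry indicator_def if_distrib[of "\<lambda>x. x * _"] cong: if_cong)
    moreover have "Z \<inter> K = Z"
      using Z by auto
    ultimately show "S k $ a $ b = signed_integral_on (\<lambda>B. \<mu> B $ a $ b) K (\<lambda>x. x ^ k)"
      using integral(2) by (simp add: S)
  qed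
  ultimately show ?thesis
    unfolding matrix_moment_sequence_def by blast
qed

section \<open>Localized block Hankel matrices\<close>

text \<open>The localizing matrix of \<open>g\<close>: block \<open>(i, j)\<close> is the moment
  functional at X^(i+j) times \<open>g\<close>.\<close>

definition localized_hankel ::
    "real poly \<Rightarrow> (nat \<Rightarrow> real ^ 'p ^ 'p) \<Rightarrow> nat \<times> 'p \<Rightarrow> nat \<times> 'p \<Rightarrow> real" where
  "localized_hankel g S = (\<lambda>(i, a) (j, b). moment_functional (\<lambda>l. S (i + j + l) $ a $ b) g)"

lemma transpose_eq_selfD: "transpose M = M \<Longrightarrow> M $ a $ b = M $ b $ a"
  by (metis transpose_def vec_lambda_beta)

lemma localized_hankel_sym:
  assumes "\<And>n. transpose (S n) = S n"
  shows "localized_hankel g S \<alpha> \<beta> = localized_hankel g S \<beta> \<alpha>"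
  using assms[THEN transpose_eq_selfD]
  by (cases \<alpha>; cases \<beta>) (simp add: localized_hankel_def add.commute)

lemma localized_hankel_atomic:
  assumes "\<And>n. S n = (\<Sum>z\<in>Z. z ^ n *\<^sub>R T z)"
  shows "localized_hankel g S (i, a) (j, b) =
    (\<Sum>z\<in>Z. poly g z * (z ^ i * T z $ a $ b * z ^ j))"
proof -
  have "localized_hankel g S (i, a) (j, b) =
      (\<Sum>l\<le>degree g. \<Sum>z\<in>Z. coeff g l * z ^ l * (z ^ i * T z $ a $ b * z ^ j))"
    by (simp add: localized_hankel_def moment_functional_def assms sum_distrib_left power_add mult_ac)
  also have "\<dots> = (\<Sum>z\<in>Z. poly g z * (z ^ i * T z $ a $ b * z ^ j))"
    by (subst sum.swap) (simp add: poly_altdef sum_distrib_right)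
  finally show ?thesis .
qed

text \<open>A block vector \<open>v\<close> is read as a vector of polynomials in \<open>z\<close>,
  one for each index \<open>a\<close>. The form splits into the forms of the \<open>T z\<close> at
  the values of these polynomials, weighted by \<open>poly g z\<close>.\<close>

lemma localized_hankel_form:
  fixes S :: "nat \<Rightarrow> real ^ 'p ^ 'p"
  assumes "\<And>n. S n = (\<Sum>z\<in>Z. z ^ n *\<^sub>R T z)"
  shows "(\<Sum>\<alpha>\<in>block_index n. \<Sum>\<beta>\<in>block_index n. v \<alpha> * localized_hankel g S \<alpha> \<beta> * v \<beta>) =
    (\<Sum>z\<in>Z. poly g z * (\<Sum>a\<in>UNIV. \<Sum>b\<in>UNIV.
      (\<Sum>i\<le>n. v (i, a) * z ^ i) * T z $ a $ b * (\<Sum>i\<le>n. v (i, b) * z ^ i)))"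
proof -
  let ?w = "\<lambda>z \<alpha>. v \<alpha> * z ^ fst \<alpha>"
  have block: "(\<Sum>\<alpha>\<in>block_index n. f \<alpha>) = (\<Sum>a\<in>UNIV. \<Sum>i\<le>n. f (i, a))" for f :: "nat \<times> 'p \<Rightarrow> real"
    unfolding block_index_def atLeast0AtMost
    by (subst sum.swap) (simp add: sum.cartesian_product)
  have "(\<Sum>\<alpha>\<in>block_index n. \<Sum>\<beta>\<in>block_index n. v \<alpha> * localized_hankel g S \<alpha> \<beta> * v \<beta>) =
      (\<Sum>\<alpha>\<in>block_index n. \<Sum>\<beta>\<in>block_index n. \<Sum>z\<in>Z.
        poly g z * (?w z \<alpha> * T z $ snd \<alpha> $ snd \<beta> * ?w z \<beta>))"
    by (intro sum.cong refl)
       (simp add: split_paired_all localized_hankel_atomic[OF assms] sum_distrib_left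
         sum_distrib_right mult_ac split: prod.split)
  also have "\<dots> = (\<Sum>z\<in>Z. poly g z * (\<Sum>\<alpha>\<in>block_index n. \<Sum>\<beta>\<in>block_index n.
        ?w z \<alpha> * T z $ snd \<alpha> $ snd \<beta> * ?w z \<beta>))"
    by (subst sum.swap[where B = Z], subst sum.swap[where B = Z]) (simp add: sum_distrib_left)
  also have "\<dots> = (\<Sum>z\<in>Z. poly g z * (\<Sum>a\<in>UNIV. \<Sum>b\<in>UNIV.
        (\<Sum>i\<le>n. v (i, a) * z ^ i) * T z $ a $ b * (\<Sum>i\<le>n. v (i, b) * z ^ i)))"
  proof (intro sum.cong refl arg_cong2[where f = "(*)"])
    fix z
    have "(\<Sum>\<alpha>\<in>block_index n. \<Sum>\<beta>\<in>block_index n. ?w z \<alpha> * T z $ snd \<alpha> $ snd \<beta> * ?w z \<beta>) =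
        (\<Sum>a\<in>UNIV. \<Sum>i\<le>n. \<Sum>b\<in>UNIV. \<Sum>j\<le>n. (v (i, a) * z ^ i) * T z $ a $ b * (v (j, b) * z ^ j))"
      by (simp add: block)
    also have "\<dots> = (\<Sum>a\<in>UNIV. \<Sum>b\<in>UNIV. \<Sum>i\<le>n. \<Sum>j\<le>n.
        (v (i, a) * z ^ i) * T z $ a $ b * (v (j, b) * z ^ j))"
      by (intro sum.cong refl sum.swap)
    also have "\<dots> = (\<Sum>a\<in>UNIV. \<Sum>b\<in>UNIV.
        (\<Sum>i\<le>n. v (i, a) * z ^ i) * T z $ a $ b * (\<Sum>i\<le>n. v (i, b) * z ^ i))"
      by (simp only: sum_distrib_left sum_distrib_right)
         (rule sum.cong[OF refl], rule sum.cong[OF refl], rule sum.swap)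
    finally show "(\<Sum>\<alpha>\<in>block_index n. \<Sum>\<beta>\<in>block_index n. ?w z \<alpha> * T z $ snd \<alpha> $ snd \<beta> * ?w z \<beta>) =
        (\<Sum>a\<in>UNIV. \<Sum>b\<in>UNIV.
          (\<Sum>i\<le>n. v (i, a) * z ^ i) * T z $ a $ b * (\<Sum>i\<le>n. v (i, b) * z ^ i))" .
  qed
  finally show ?thesis .
qed

lemma psd_localized_hankel:
  fixes S :: "nat \<Rightarrow> real ^ 'p ^ 'p"
  assumes sym: "\<And>n. transpose (S n) = S n" and S: "\<And>n. S n = (\<Sum>z\<in>Z. z ^ n *\<^sub>R T z)"
    and psd: "\<And>z. z \<in> Z \<Longrightarrow> psd_on UNIV (\<lambda>a b. T z $ a $ b)"
    and g: "\<And>z. z \<in> Z \<Longrightarrow> 0 \<le> poly g z"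
  shows "psd_on (block_index n) (localized_hankel g S)"
  unfolding psd_on_def localized_hankel_form[OF S]
proof (intro conjI ballI allI sum_nonneg)
  fix v :: "nat \<times> 'p \<Rightarrow> real" and z assume "z \<in> Z"
  then show "0 \<le> poly g z * (\<Sum>a\<in>UNIV. \<Sum>b\<in>UNIV.
      (\<Sum>i\<le>n. v (i, a) * z ^ i) * T z $ a $ b * (\<Sum>i\<le>n. v (i, b) * z ^ i))"
    using psd[of z, unfolded psd_on_def, THEN conjunct2, rule_format, of "\<lambda>a. \<Sum>i\<le>n. v (i, a) * z ^ i"]
      g[of z] by (intro mult_nonneg_nonneg)
qed (rule localized_hankel_sym[OF sym])

text \<open>
  Testing against \<open>coeff L i * w a\<close>, with \<open>L\<close> the Lagrange basis polynomial of the node \<open>z\<close>, isolates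
  the summand of \<open>z\<close>.
\<close>

lemma psd_localized_hankel_at_node:
  fixes S :: "nat \<Rightarrow> real ^ 'p ^ 'p"
  assumes S: "\<And>n. S n = (\<Sum>z\<in>Z. z ^ n *\<^sub>R T z)" and Z: "finite Z" "z \<in> Z"
    and psd: "psd_on (block_index (card Z - 1)) (localized_hankel g S)"
  shows "0 \<le> poly g z * (\<Sum>a\<in>UNIV. \<Sum>b\<in>UNIV. w a * T z $ a $ b * w b)"
proof -
  obtain L where deg: "degree L < card Z" and L: "\<And>x. x \<in> Z \<Longrightarrow> poly L x = (if x = z then 1 else 0)"
    using lagrange_basis_exists[OF Z] by metis
  define v where "v = (\<lambda>(i, a). coeff L i * w a)"
  have eval: "(\<Sum>i\<le>card Z - 1. v (i, a) * x ^ i) = poly L x * w a" for a x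
  proof -
    have "poly L x = (\<Sum>i\<le>card Z - 1. coeff L i * x ^ i)"
      unfolding poly_altdef
      by (rule sum.mono_neutral_left) (use deg in \<open>auto simp: coeff_eq_0\<close>)
    then show ?thesis
      by (simp add: v_def sum_distrib_left mult_ac)
  qed
  have "0 \<le> (\<Sum>\<alpha>\<in>block_index (card Z - 1). \<Sum>\<beta>\<in>block_index (card Z - 1).
      v \<alpha> * localized_hankel g S \<alpha> \<beta> * v \<beta>)"
    using psd by (simp add: psd_on_def)
  also have "\<dots> = (\<Sum>x\<in>Z. if x = z then
      poly g z * (\<Sum>a\<in>UNIV. \<Sum>b\<in>UNIV. w a * T z $ a $ b * w b) else 0)"
    unfolding localized_hankel_form[OF S] eval by (intro sum.cong) (auto simp: L)
  also have "\<dots> = poly g z * (\<Sum>a\<in>UNIV. \<Sum>b\<in>UNIV. w a * T z $ a $ b * w b)"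
    using Z by simp
  finally show ?thesis .
qed

text \<open>The matrix for 1 controls the weights and the matrix for \<open>g\<close> the location
  of the nodes.\<close>

theorem moment_sequence_iff_localized_hankel:
  fixes S :: "nat \<Rightarrow> real ^ 'p ^ 'p"
  assumes rec: "linearly_recursive S" and sym: "\<And>n. transpose (S n) = S n"
    and roots: "real_distinct_roots (minimal_poly S)"
  defines "n \<equiv> recurrence_order S - 1"
  shows "matrix_moment_sequence {x. 0 \<le> poly g x} S \<longleftrightarrow>
    psd_on (block_index n) (localized_hankel 1 S) \<and> psd_on (block_index n) (localized_hankel g S)"
    (is "matrix_moment_sequence ?K S \<longleftrightarrow> ?psd")
proof -
  have K: "?K \<in> sets borel"
    using closed_Collect_le[of "\<lambda>_. 0" "poly g"] by (simp add: continuous_on_poly)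
  show ?thesis
  proof
    assume moments: "matrix_moment_sequence ?K S"
    obtain Z T where "Z \<subseteq> ?K" and T: "\<And>z. psd_on UNIV (\<lambda>a b. T z $ a $ b)"
        and S: "\<And>n. S n = (\<Sum>z\<in>Z. z ^ n *\<^sub>R T z)"
      by (rule matrix_moment_sequence_imp_atomic[OF rec moments K]) (rule that)
    then show ?psd
      by (intro conjI psd_localized_hankel[OF sym S T]) auto
  next
    assume ?psd
    define Z where "Z = {x. poly (minimal_poly S) x = 0}"
    have "minimal_poly S \<noteq> 0"
      using minimal_poly(1)[OF rec] by auto
    \<comment> \<open>Thus \<open>n = card Z - 1\<close>, which is exactly the degree bound for the
      Lagrange polynomials of the nodes.\<close>
    then have Z: "finite Z" "card Z = recurrence_order S"
      using card_real_distinct_roots[OF roots]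
      by (auto simp: Z_def recurrence_order_def poly_roots_finite)
    obtain T where S: "\<And>n. S n = (\<Sum>z\<in>Z. z ^ n *\<^sub>R T z)"
        and T: "\<And>z. z \<in> Z \<Longrightarrow> T z \<noteq> 0" "\<And>z. T z \<in> span (range S)"
      by (rule recursive_atomic_representation[OF minimal_poly(2)[OF rec] \<open>minimal_poly S \<noteq> 0\<close>
            card_real_distinct_roots[OF roots \<open>minimal_poly S \<noteq> 0\<close>], folded Z_def]) (rule that)
    \<comment> \<open>Symmetric matrices form a subspace containing every \<open>S n\<close>, hence
      every \<open>T z\<close>.\<close>
    have "span (range S) \<subseteq> {M. \<forall>a b. M $ a $ b = M $ b $ a}"
      using sym[THEN transpose_eq_selfD]
      by (intro span_minimal) (auto simp: subspace_def)
    then have T_sym: "T z $ a $ b = T z $ b $ a" for z a b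
      using T(2)[of z] by blast
    have node: "0 \<le> poly h z * (\<Sum>a\<in>UNIV. \<Sum>b\<in>UNIV. w a * T z $ a $ b * w b)"
      if "h \<in> {1, g}" "z \<in> Z" for h z w
      using that \<open>?psd\<close> Z by (intro psd_localized_hankel_at_node[OF S]) (auto simp: n_def)
    have psd: "psd_on UNIV (\<lambda>a b. T z $ a $ b)" if "z \<in> Z" for z
      using node[of 1 z] that by (simp add: psd_on_def T_sym)
    have "0 \<le> poly g z" if z: "z \<in> Z" for z
    proof -
      \<comment> \<open>A nonzero positive semidefinite matrix has a positive diagonal entry;
        testing with its unit vector reveals the sign of \<open>poly g z\<close>.\<close>
      obtain a where "T z $ a $ a \<noteq> 0"
        using T(1)[OF z] psd_on_diag_eq_0[OF psd[OF z]] by (auto simp: vec_eq_iff)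
      then have "0 < T z $ a $ a"
        using psd_on_diag_nonneg[OF psd[OF z], of a] by simp
      moreover have "0 \<le> poly g z * T z $ a $ a"
        using node[of g z "\<lambda>i. of_bool (i = a)"] z sum_unit_vectors[of a "\<lambda>a b. T z $ a $ b" a] by simp
      ultimately show ?thesis
        by (simp add: zero_le_mult_iff)
    qed
    then show "matrix_moment_sequence ?K S"
      using Z psd by (intro atomic_imp_matrix_moment_sequence[OF _ _ K _ S]) auto
  qed
qed

theorem theorem4p4:
  fixes S :: "nat \<Rightarrow> real ^ 'p ^ 'p" and r :: nat
  assumes "1 \<le> r"
    and "linearly_recursive S"
    and "\<And>n. transpose (S n) = S n"
    and "recurrence_order S = r"
    and "real_distinct_roots (minimal_poly S)"
  shows "(stieltjes_moment_sequence S \<longleftrightarrow>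
            psd_on (block_index (r - 1)) (block_hankel S 0) \<and>
            psd_on (block_index (r - 1)) (block_hankel S 1)) \<and>
         (hausdorff_moment_sequence S \<longleftrightarrow>
            psd_on (block_index (r - 1)) (block_hankel S 0) \<and>
            psd_on (block_index (r - 1))
              (\<lambda>\<alpha> \<beta>. block_hankel S 1 \<alpha> \<beta> - block_hankel S 2 \<alpha> \<beta>))"
proof -
  have hankel: "localized_hankel 1 S = block_hankel S 0"
    "localized_hankel [:0, 1:] S = block_hankel S 1"
    "localized_hankel [:0, 1, - 1:] S = (\<lambda>\<alpha> \<beta>. block_hankel S 1 \<alpha> \<beta> - block_hankel S 2 \<alpha> \<beta>)"
    by (auto simp: fun_eq_iff localized_hankel_def block_hankel_def moment_functional_def
        numeral_2_eq_2)
  have "{0::real..} = {x. 0 \<le> poly [:0, 1:] x}"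
    by auto
  \<comment> \<open>The polynomial is \<open>x * (1 - x)\<close>, nonnegative exactly between its
    roots.\<close>
  moreover have "{0::real..1} = {x. 0 \<le> poly [:0, 1, - 1:] x}"
    by (auto simp: zero_le_mult_iff)
  ultimately show ?thesis
    unfolding stieltjes_moment_sequence_def hausdorff_moment_sequence_def
    using moment_sequence_iff_localized_hankel[OF assms(2,3,5), of "[:0, 1:]"]
      moment_sequence_iff_localized_hankel[OF assms(2,3,5), of "[:0, 1, - 1:]"]
    by (simp only: hankel assms(4))
qed

end
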